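(* The $3$-dimensional Heisenberg group $\mathcal{H}$ is not strongly relatively hyperbolic.
   Context: The $3$-dimensional Heisenberg group is given by the presentation $\mathcal{H}=\langle a,b,c\mid [a,b]=c,\ [a,c]=1=[b,c]\rangle$. A finitely generated group is called not strongly relatively hyperbolic if it is not strongly hyperbolic relative to any finite collection of proper finitely generated subgroups. Here a group $G$ is strongly hyperbolic relative to a family $L_1,\dots,L_m$ ($m\ge 1$) of proper finitely generated subgroups if $G$ admits an action on a connected graph $\mathcal{G}$ such that: $\mathcal{G}$ (with all edges of length one) is hyperbolic in the sense of Gromov; $\mathcal{G}$ is fine, i.e. for each $n\in\mathbf{N}$ each edge of $\mathcal{G}$ belongs to only finitely many circuits (closed edge paths without repeated vertices) of length $n$; there are only finitely many $G$-orbits of edges; each edge stabiliser is finite; and the stabilisers of the vertices of infinite valence are precisely the conjugates of the $L_j$. *)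

theory Defs
  imports Complex_Main "HOL-Algebra.Group_Action" "HOL-Algebra.Generated_Groups"
begin

section \<open>Groups given by presentations\<close>

text \<open>
  A letter is a generator (sign \<^const>\<open>True\<close>) or the formal inverse of a generator
  (sign \<^const>\<open>False\<close>). All elements of the type \<open>'g\<close> are generators.
\<close>

type_synonym 'g word = "('g \<times> bool) list"

definition inv_word :: "'g word \<Rightarrow> 'g word" where
  "inv_word w = rev (map (\<lambda>(x, s). (x, \<not> s)) w)"

definition comm_word :: "'g word \<Rightarrow> 'g word \<Rightarrow> 'g word" where
  "comm_word u v = u @ v @ inv_word u @ inv_word v"

text \<open>
  A presentation is a set \<open>R\<close> of pairs of words, a pair \<open>(r, r')\<close> standing for the
  equation \<open>r = r'\<close>. Two words are equal in the presented group iff they are related by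
  the equivalence relation generated by free cancellation and replacing \<open>r\<close> by \<open>r'\<close>.
\<close>

inductive word_step :: "('g word \<times> 'g word) set \<Rightarrow> 'g word \<Rightarrow> 'g word \<Rightarrow> bool"
  for R where
  cancel: "word_step R (u @ [(x, s), (x, \<not> s)] @ v) (u @ v)"
| relation: "(r, r') \<in> R \<Longrightarrow> word_step R (u @ r @ v) (u @ r' @ v)"

definition word_rel :: "('g word \<times> 'g word) set \<Rightarrow> ('g word \<times> 'g word) set" where
  "word_rel R = {(u, v). equivclp (word_step R) u v}"

definition presented_group :: "('g word \<times> 'g word) set \<Rightarrow> 'g word set monoid" where
  "presented_group R =
     \<lparr> carrier = UNIV // word_rel R,
       mult = (\<lambda>A B. \<Union>u\<in>A. \<Union>v\<in>B. word_rel R `` {u @ v}),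
       one = word_rel R `` {[]} \<rparr>"

datatype heisenberg_gen = a | b | c

text \<open>The convention for commutators is \<open>[x, y] = x y x\<inverse> y\<inverse>\<close>.\<close>

definition heisenberg_group :: "heisenberg_gen word set monoid" where
  "heisenberg_group = presented_group
     { (comm_word [(a, True)] [(b, True)], [(c, True)]),
       (comm_word [(a, True)] [(c, True)], []),
       (comm_word [(b, True)] [(c, True)], []) }"

hide_const (open) a b c


section \<open>Graphs\<close>

text \<open>
  Undirected graphs; loops and multiple edges are allowed. The set \<open>ends \<Gamma> e\<close> of endpoints
  of an edge has two elements, or one if \<open>e\<close> is a loop.
\<close>

record ('v, 'e) ugraph =
  verts :: "'v set"
  edges :: "'e set"
  ends :: "'e \<Rightarrow> 'v set"

definition is_graph :: "('v, 'e) ugraph \<Rightarrow> bool" where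
  "is_graph \<Gamma> \<longleftrightarrow> (\<forall>e\<in>edges \<Gamma>. ends \<Gamma> e \<subseteq> verts \<Gamma> \<and> card (ends \<Gamma> e) \<in> {1, 2})"

primrec edge_path :: "('v, 'e) ugraph \<Rightarrow> 'v \<Rightarrow> 'e list \<Rightarrow> 'v \<Rightarrow> bool" where
  "edge_path \<Gamma> u [] v \<longleftrightarrow> u \<in> verts \<Gamma> \<and> u = v"
| "edge_path \<Gamma> u (e # es) v \<longleftrightarrow>
     e \<in> edges \<Gamma> \<and> (\<exists>w. ends \<Gamma> e = {u, w} \<and> edge_path \<Gamma> w es v)"

definition connected_graph :: "('v, 'e) ugraph \<Rightarrow> bool" where
  "connected_graph \<Gamma> \<longleftrightarrow>
     verts \<Gamma> \<noteq> {} \<and> (\<forall>u\<in>verts \<Gamma>. \<forall>v\<in>verts \<Gamma>. \<exists>es. edge_path \<Gamma> u es v)"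

definition graph_dist :: "('v, 'e) ugraph \<Rightarrow> 'v \<Rightarrow> 'v \<Rightarrow> nat" where
  "graph_dist \<Gamma> u v = (LEAST n. \<exists>es. edge_path \<Gamma> u es v \<and> length es = n)"

definition infinite_valence :: "('v, 'e) ugraph \<Rightarrow> 'v \<Rightarrow> bool" where
  "infinite_valence \<Gamma> v \<longleftrightarrow> infinite {e \<in> edges \<Gamma>. v \<in> ends \<Gamma> e}"

text \<open>
  In a circuit the edge \<open>es ! i\<close> joins \<open>vs ! i\<close> to its cyclic successor. Distinctness of
  the edges only matters for length 2, where it excludes running back along the same edge.
  Each circuit is counted once for every choice of base point and direction, which does not
  affect finiteness.
\<close>

definition circuit :: "('v, 'e) ugraph \<Rightarrow> 'v list \<Rightarrow> 'e list \<Rightarrow> bool" where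
  "circuit \<Gamma> vs es \<longleftrightarrow>
     es \<noteq> [] \<and> length vs = length es \<and> distinct vs \<and> distinct es \<and>
     set vs \<subseteq> verts \<Gamma> \<and> set es \<subseteq> edges \<Gamma> \<and>
     (\<forall>i < length es. ends \<Gamma> (es ! i) = {vs ! i, vs ! (Suc i mod length es)})"

definition fine_graph :: "('v, 'e) ugraph \<Rightarrow> bool" where
  "fine_graph \<Gamma> \<longleftrightarrow>
     (\<forall>n. \<forall>e\<in>edges \<Gamma>. finite {(vs, es). circuit \<Gamma> vs es \<and> length es = n \<and> e \<in> set es})"


section \<open>Hyperbolicity\<close>

definition gromov_product :: "('p \<Rightarrow> 'p \<Rightarrow> real) \<Rightarrow> 'p \<Rightarrow> 'p \<Rightarrow> 'p \<Rightarrow> real" where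
  "gromov_product d x y w = (d x w + d y w - d x y) / 2"

definition gromov_hyperbolic :: "'p set \<Rightarrow> ('p \<Rightarrow> 'p \<Rightarrow> real) \<Rightarrow> bool" where
  "gromov_hyperbolic X d \<longleftrightarrow>
     (\<exists>\<delta>\<ge>0. \<forall>x\<in>X. \<forall>y\<in>X. \<forall>z\<in>X. \<forall>w\<in>X.
        gromov_product d x z w
          \<ge> min (gromov_product d x y w) (gromov_product d y z w) - \<delta>)"

text \<open>
  The geometric realisation of a connected graph with all edges of length one. After
  orienting each edge arbitrarily, the pair \<open>(e, t)\<close> is the point of \<open>e\<close> at distance \<open>t\<close>
  from \<open>src \<Gamma> e\<close> along \<open>e\<close>. A vertex is represented by an endpoint of every edge incident
  to it, and \<open>real_dist\<close> is the path metric pulled back to these pairs (a pseudometric).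
  A shortest path between two points either stays inside a common edge or leaves the first
  edge and enters the second one through endpoints.
\<close>

definition src :: "('v, 'e) ugraph \<Rightarrow> 'e \<Rightarrow> 'v" where
  "src \<Gamma> e = (SOME u. u \<in> ends \<Gamma> e)"

definition tgt :: "('v, 'e) ugraph \<Rightarrow> 'e \<Rightarrow> 'v" where
  "tgt \<Gamma> e = (SOME w. ends \<Gamma> e = {src \<Gamma> e, w})"

definition realisation :: "('v, 'e) ugraph \<Rightarrow> ('e \<times> real) set" where
  "realisation \<Gamma> = edges \<Gamma> \<times> {0..1}"

definition real_dist :: "('v, 'e) ugraph \<Rightarrow> 'e \<times> real \<Rightarrow> 'e \<times> real \<Rightarrow> real" where
  "real_dist \<Gamma> = (\<lambda>(e, s) (f, t).
     Min ({s + real (graph_dist \<Gamma> (src \<Gamma> e) (src \<Gamma> f)) + t,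
           s + real (graph_dist \<Gamma> (src \<Gamma> e) (tgt \<Gamma> f)) + (1 - t),
           (1 - s) + real (graph_dist \<Gamma> (tgt \<Gamma> e) (src \<Gamma> f)) + t,
           (1 - s) + real (graph_dist \<Gamma> (tgt \<Gamma> e) (tgt \<Gamma> f)) + (1 - t)}
          \<union> (if e = f then {\<bar>s - t\<bar>} else {})))"

definition hyperbolic_graph :: "('v, 'e) ugraph \<Rightarrow> bool" where
  "hyperbolic_graph \<Gamma> \<longleftrightarrow> gromov_hyperbolic (realisation \<Gamma>) (real_dist \<Gamma>)"


section \<open>Strong relative hyperbolicity\<close>

definition acts_on_graph ::
  "('a, 'm) monoid_scheme \<Rightarrow> ('v, 'e) ugraph \<Rightarrow> ('a \<Rightarrow> 'v \<Rightarrow> 'v) \<Rightarrow> ('a \<Rightarrow> 'e \<Rightarrow> 'e) \<Rightarrow> bool"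
  where
  "acts_on_graph G \<Gamma> \<phi> \<psi> \<longleftrightarrow>
     group_action G (verts \<Gamma>) \<phi> \<and> group_action G (edges \<Gamma>) \<psi> \<and>
     (\<forall>g\<in>carrier G. \<forall>e\<in>edges \<Gamma>. ends \<Gamma> (\<psi> g e) = \<phi> g ` ends \<Gamma> e)"

definition finitely_generated :: "('a, 'm) monoid_scheme \<Rightarrow> 'a set \<Rightarrow> bool" where
  "finitely_generated G H \<longleftrightarrow> (\<exists>S. finite S \<and> S \<subseteq> H \<and> generate G S = H)"

text \<open>
  The type arguments are the types from which the vertices and edges of the graph are taken.
  HOL cannot quantify over types inside a definition, so a statement that no graph exists has
  to be made for all types \<open>'v\<close> and \<open>'e\<close>, i.e. with \<open>'v\<close> and \<open>'e\<close> left as type variables.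
\<close>

definition strongly_hyperbolic_relative_to ::
  "'v itself \<Rightarrow> 'e itself \<Rightarrow> ('a, 'm) monoid_scheme \<Rightarrow> 'a set set \<Rightarrow> bool" where
  "strongly_hyperbolic_relative_to TYPE('v) TYPE('e) G \<L> \<longleftrightarrow>
     (\<exists>(\<Gamma> :: ('v, 'e) ugraph) \<phi> \<psi>.
        is_graph \<Gamma> \<and> connected_graph \<Gamma> \<and> acts_on_graph G \<Gamma> \<phi> \<psi> \<and>
        hyperbolic_graph \<Gamma> \<and> fine_graph \<Gamma> \<and>
        finite (orbits G (edges \<Gamma>) \<psi>) \<and>
        (\<forall>e\<in>edges \<Gamma>. finite (stabilizer G \<psi> e)) \<and>
        {stabilizer G \<phi> v | v. v \<in> verts \<Gamma> \<and> infinite_valence \<Gamma> v} =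
          {g <#\<^bsub>G\<^esub> L #>\<^bsub>G\<^esub> inv\<^bsub>G\<^esub> g | g L. g \<in> carrier G \<and> L \<in> \<L>})"

definition not_strongly_relatively_hyperbolic ::
  "'v itself \<Rightarrow> 'e itself \<Rightarrow> ('a, 'm) monoid_scheme \<Rightarrow> bool" where
  "not_strongly_relatively_hyperbolic TYPE('v) TYPE('e) G \<longleftrightarrow>
     group G \<and> finitely_generated G (carrier G) \<and>
     (\<forall>\<L>. finite \<L> \<and> \<L> \<noteq> {} \<and>
          (\<forall>L\<in>\<L>. subgroup L G \<and> L \<noteq> carrier G \<and> finitely_generated G L) \<longrightarrow>
        \<not> strongly_hyperbolic_relative_to TYPE('v) TYPE('e) G \<L>)"

end

theory Submission
  imports Defs
begin

text \<open>
  In a fine graph on which a group acts with finite edge stabilisers, two distinct vertices have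
  stabilisers with finite intersection: otherwise a shortest walk between such a pair and its
  infinitely many translates would form infinitely many circuits through one edge. If there are
  only finitely many orbits of edges, then a vertex \<open>v\<close> of infinite valence has an infinite
  stabiliser \<open>L\<close>. A central element \<open>z\<close> makes \<open>L\<close> fix both \<open>v\<close> and \<open>z v\<close>, so \<open>z v = v\<close>. If the
  centre is infinite, then it fixes \<open>v\<close> and \<open>g v\<close> for every \<open>g\<close>, so \<open>g v = v\<close> and \<open>L\<close> is the
  whole group. In the Heisenberg group \<open>c\<close> is central, and it has infinite order because it
  has infinite order in the group of integer upper unitriangular matrices.
\<close>

section \<open>Circuits formed by two shortest walks with common endpoints\<close>

section \<open>Walks and circuits\<close>

text \<open>Total functions replace lists, so that an initial piece of a walk is the same pair
  \<open>x\<close>, \<open>e\<close> with a smaller \<open>n\<close>, and a translate is obtained by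
  composing with the action.\<close>

definition walk :: "('v, 'e) ugraph \<Rightarrow> (nat \<Rightarrow> 'v) \<Rightarrow> (nat \<Rightarrow> 'e) \<Rightarrow> nat \<Rightarrow> bool" where
  "walk \<Gamma> x e n \<longleftrightarrow> (\<forall>i<n. e i \<in> edges \<Gamma> \<and> ends \<Gamma> (e i) = {x i, x (Suc i)})"

lemma walk_edge:
  assumes "walk \<Gamma> x e n" "i < n"
  shows "e i \<in> edges \<Gamma>" "ends \<Gamma> (e i) = {x i, x (Suc i)}"
  using assms by (auto simp: walk_def)

lemma edge_path_imp_walk:
  assumes "edge_path \<Gamma> u es v"
  shows "\<exists>x e. walk \<Gamma> x e (length es) \<and> x 0 = u \<and> x (length es) = v"
  using assms
proof (induction es arbitrary: u)
  case Nil
  then show ?case by (auto simp: walk_def)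
next
  case (Cons d es)
  then obtain w where d: "d \<in> edges \<Gamma>" "ends \<Gamma> d = {u, w}" and "edge_path \<Gamma> w es v"
    by auto
  with Cons.IH obtain x e where "walk \<Gamma> x e (length es)" "x 0 = w" "x (length es) = v"
    by blast
  with d have "walk \<Gamma> (case_nat u x) (case_nat d e) (length (d # es))"
    by (auto simp: walk_def split: nat.split)
  moreover have "case_nat u x (length (d # es)) = v"
    using \<open>x (length es) = v\<close> by simp
  ultimately show ?case by (metis nat.case(1))
qed

text \<open>Follow the first walk up to the common vertex \<open>x i = y j\<close> and continue
  along the second. The resulting length is what gets compared with a minimal one.\<close>

lemma walk_splice:
  assumes x: "walk \<Gamma> x e n" and y: "walk \<Gamma> y f m" and "i \<le> n" "j \<le> m" "x i = y j"
  shows "\<exists>z d. walk \<Gamma> z d (i + (m - j)) \<and> z 0 = x 0 \<and> z (i + (m - j)) = y m"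
proof -
  let ?z = "\<lambda>t. if t \<le> i then x t else y (t - i + j)"
  let ?d = "\<lambda>t. if t < i then e t else f (t - i + j)"
  have "walk \<Gamma> ?z ?d (i + (m - j))"
    unfolding walk_def
  proof (intro allI impI)
    fix t assume t: "t < i + (m - j)"
    consider "t < i" | "t = i" | "t > i" by linarith
    then show "?d t \<in> edges \<Gamma> \<and> ends \<Gamma> (?d t) = {?z t, ?z (Suc t)}"
    proof cases
      case 1
      then show ?thesis using walk_edge[OF x, of t] \<open>i \<le> n\<close> by auto
    next
      case 2
      then show ?thesis using walk_edge[OF y, of j] \<open>x i = y j\<close> t by auto
    next
      case 3
      then show ?thesis using walk_edge[OF y, of "t - i + j"] t by (auto simp: Suc_diff_le)
    qed
  qed
  moreover have "?z (i + (m - j)) = y m"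
    using assms by (cases "j = m") auto
  ultimately show ?thesis
    by (intro exI[of _ ?z] exI[of _ ?d]) auto
qed

text \<open>Switching walks at the common vertex gives walks of lengths \<open>i + (n - j)\<close>
  and \<open>j + (n - i)\<close> between the same endpoints. Minimality bounds both below by
  \<open>n\<close>, which forces \<open>j \<le> i\<close> and \<open>i \<le> j\<close>. Taking both
  walks equal shows that a shortest walk repeats no vertex.\<close>

lemma shortest_walks_levels:
  assumes "walk \<Gamma> x e n" "walk \<Gamma> y f n" "x 0 = y 0" "x n = y n"
    and minimal: "\<And>z d m. walk \<Gamma> z d m \<Longrightarrow> z 0 = x 0 \<Longrightarrow> z m = x n \<Longrightarrow> n \<le> m"
    and "i \<le> n" "j \<le> n" "x i = y j"
  shows "i = j"
proof -
  have "n \<le> i + (n - j)"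
    using walk_splice[of \<Gamma> x e n y f n i j] assms by metis
  moreover have "n \<le> j + (n - i)"
    using walk_splice[of \<Gamma> y f n x e n j i] assms by metis
  ultimately show ?thesis using assms by linarith
qed

text \<open>The circuit goes out along \<open>x\<close> and back along \<open>y\<close>. Vertices
  can coincide only at equal levels, and \<open>inner\<close> rules this out strictly between the
  ends. For \<open>n = 1\<close> it is \<open>edge\<close> that makes the two parallel edges
  distinct.\<close>

lemma walks_circuit:
  assumes graph: "is_graph \<Gamma>" and x: "walk \<Gamma> x e n" and y: "walk \<Gamma> y f n"
    and "n > 0" "x 0 = y 0" "x n = y n"
    and xx: "\<And>i j. \<lbrakk>i \<le> n; j \<le> n; x i = x j\<rbrakk> \<Longrightarrow> i = j"
    and yy: "\<And>i j. \<lbrakk>i \<le> n; j \<le> n; y i = y j\<rbrakk> \<Longrightarrow> i = j"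
    and xy: "\<And>i j. \<lbrakk>i \<le> n; j \<le> n; x i = y j\<rbrakk> \<Longrightarrow> i = j"
    and inner: "\<And>i. \<lbrakk>0 < i; i < n\<rbrakk> \<Longrightarrow> x i \<noteq> y i"
    and edge: "\<And>i. i < n \<Longrightarrow> e i \<noteq> f i"
  shows "circuit \<Gamma> (map (\<lambda>t. if t \<le> n then x t else y (2 * n - t)) [0..<2 * n])
                   (map (\<lambda>t. if t < n then e t else f (2 * n - 1 - t)) [0..<2 * n])"
    (is "circuit \<Gamma> (map ?v _) (map ?d _)")
proof -
  \<comment> \<open>Equal edges have equal endpoint sets. A crossed match
    \<open>p i = q (Suc j)\<close> gives \<open>i = Suc j\<close>, which is incompatible with both
    possible matches of \<open>p (Suc i)\<close>; so the edges sit at the same level.\<close>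
  have levels: "i = j"
    if "{p i, p (Suc i)} = {q j, q (Suc j)}" "i < n" "j < n"
      and pq: "\<And>i j. \<lbrakk>i \<le> n; j \<le> n; p i = q j\<rbrakk> \<Longrightarrow> i = j"
    for p q :: "nat \<Rightarrow> 'a" and i j
  proof -
    have "p i = q j \<or> p i = q (Suc j)" "p (Suc i) = q j \<or> p (Suc i) = q (Suc j)"
      using that(1) by auto
    then show ?thesis
      using pq[of i j] pq[of i "Suc j"] pq[of "Suc i" j] pq[of "Suc i" "Suc j"] that(2,3)
      by auto
  qed
  have ee: "i = j" if "e i = e j" "i < n" "j < n" for i j
    using levels[of x i x j] xx walk_edge[OF x] that by metis
  have ff: "i = j" if "f i = f j" "i < n" "j < n" for i j
    using levels[of y i y j] yy walk_edge[OF y] that by metis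
  have ef: "e i \<noteq> f j" if "i < n" "j < n" for i j
    using levels[of x i y j] xy walk_edge[OF x] walk_edge[OF y] edge that by metis
  \<comment> \<open>Here \<open>2 * n - t\<close> lies strictly between 0 and \<open>n\<close>, so a
    coincidence would be one at an inner level.\<close>
  have vs_cross: "x s \<noteq> y (2 * n - t)" if "s \<le> n" "n < t" "t < 2 * n" for s t
    using xy[of s "2 * n - t"] inner[of s] that by auto
  have inj_v: "inj_on ?v {0..<2 * n}"
  proof (rule inj_onI)
    fix s t assume st: "s \<in> {0..<2 * n}" "t \<in> {0..<2 * n}" "?v s = ?v t"
    consider "s \<le> n" "t \<le> n" | "s \<le> n" "t > n" | "s > n" "t \<le> n" | "s > n" "t > n"
      by linarith
    then show "s = t"
    proof cases
      case 1
      then show ?thesis using xx st by auto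
    next
      case 2
      then show ?thesis using vs_cross[of s t] st by auto
    next
      case 3
      then show ?thesis using vs_cross[of t s] st by auto
    next
      case 4
      then have "2 * n - s = 2 * n - t"
        using st by (intro yy) auto
      then show ?thesis using 4 st by auto
    qed
  qed
  have inj_d: "inj_on ?d {0..<2 * n}"
  proof (rule inj_onI)
    fix s t assume st: "s \<in> {0..<2 * n}" "t \<in> {0..<2 * n}" "?d s = ?d t"
    consider "s < n" "t < n" | "s < n" "t \<ge> n" | "s \<ge> n" "t < n" | "s \<ge> n" "t \<ge> n"
      by linarith
    then show "s = t"
    proof cases
      case 1
      then show ?thesis using ee st by auto
    next
      case 2
      then show ?thesis using ef[of s "2 * n - 1 - t"] st by auto
    next
      case 3
      then have "2 * n - 1 - s < n" using st by auto
      then show ?thesis using ef[of t "2 * n - 1 - s"] st 3 by auto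
    next
      case 4
      then have "2 * n - 1 - s = 2 * n - 1 - t"
        using st by (intro ff) auto
      then show ?thesis using 4 st by auto
    qed
  qed
  have step: "?d t \<in> edges \<Gamma> \<and> ends \<Gamma> (?d t) = {?v t, ?v (Suc t mod (2 * n))}"
    if "t < 2 * n" for t
  proof (cases "t < n")
    case True
    then show ?thesis using walk_edge[OF x, of t] by auto
  next
    case False
    \<comment> \<open>Position \<open>t\<close> on the way back runs along \<open>f i\<close> from
      \<open>y (Suc i)\<close> to \<open>y i\<close>. At \<open>t = n\<close> the vertex list still
      shows \<open>x n\<close>, and at \<open>i = 0\<close> the successor wraps around to
      \<open>x 0\<close>; the common endpoints of the walks settle both cases.\<close>
    define i where "i = 2 * n - 1 - t"
    have i: "i < n" "2 * n - t = Suc i" "t \<ge> n" "t = 2 * n - Suc i"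
      using False that by (auto simp: i_def)
    have "?v t = y (Suc i)"
    proof (cases "t = n")
      case True
      then show ?thesis using i \<open>x n = y n\<close> by (metis le_refl add_diff_cancel_right' mult_2)
    qed (use i in auto)
    moreover have "?v (Suc t mod (2 * n)) = y i"
    proof (cases "i = 0")
      case True
      then have "Suc t = 2 * n" using i by auto
      then show ?thesis using True \<open>x 0 = y 0\<close> by simp
    next
      case False
      then have "Suc t < 2 * n" "2 * n - Suc t = i" using i by auto
      then show ?thesis using i by simp
    qed
    moreover have "?d t = f i" using False by (simp add: i_def)
    ultimately show ?thesis using walk_edge[OF y, of i] i(1) by auto
  qed
  have vert: "?v t \<in> verts \<Gamma>" if "t < 2 * n" for t
    using step[OF that] graph unfolding is_graph_def by blast
  show ?thesis
    unfolding circuit_def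
  proof (intro conjI allI impI)
    show "map ?d [0..<2 * n] \<noteq> []" using \<open>n > 0\<close> by simp
    show "distinct (map ?v [0..<2 * n])" unfolding distinct_map using inj_v by simp
    show "distinct (map ?d [0..<2 * n])" unfolding distinct_map using inj_d by simp
    show "set (map ?v [0..<2 * n]) \<subseteq> verts \<Gamma>"
      unfolding set_map set_upt by (intro image_subsetI vert) simp
    show "set (map ?d [0..<2 * n]) \<subseteq> edges \<Gamma>"
      unfolding set_map set_upt by (intro image_subsetI step[THEN conjunct1]) simp
    fix t assume "t < length (map ?d [0..<2 * n])"
    then have t: "t < 2 * n" by simp
    then have "Suc t mod (2 * n) < 2 * n" by simp
    with t show "ends \<Gamma> (map ?d [0..<2 * n] ! t) =
        {map ?v [0..<2 * n] ! t,
         map ?v [0..<2 * n] ! (Suc t mod length (map ?d [0..<2 * n]))}"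
      using step[OF t, THEN conjunct2]
      by (simp only: nth_map length_map length_upt nth_upt diff_zero add_0)
  qed simp
qed

section \<open>Vertex stabilisers in fine graphs, and groups with infinite centre\<close>

section \<open>Group actions on fine graphs\<close>

text \<open>The elements sending \<open>x\<close> to a given point lie in one left coset of the
  stabiliser of \<open>x\<close>, so the orbit map has finite fibres.\<close>

lemma (in group_action) finite_of_finite_image:
  assumes S: "S \<subseteq> carrier G" and x: "x \<in> E" and stab: "finite (stabilizer G \<phi> x)"
    and img: "finite ((\<lambda>g. \<phi> g x) ` S)"
  shows "finite S"
proof -
  interpret group G using group_hom group_hom.axioms(1) by blast
  have "finite {g \<in> S. \<phi> g x = y}" for y
  proof (cases "\<exists>h\<in>S. \<phi> h x = y")
    case True
    then obtain h where h: "h \<in> carrier G" "\<phi> h x = y" using S by auto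
    have "{g \<in> S. \<phi> g x = y} \<subseteq> (\<lambda>k. h \<otimes> k) ` stabilizer G \<phi> x"
    proof
      fix g assume "g \<in> {g \<in> S. \<phi> g x = y}"
      then have g: "g \<in> carrier G" "\<phi> g x = y" using S by auto
      have "\<phi> (inv h \<otimes> g) x = x"
        using composition_rule[OF x, of "inv h" g] orbit_sym_aux[OF h(1) x h(2)] g h by simp
      then have "inv h \<otimes> g \<in> stabilizer G \<phi> x"
        using g h by (simp add: stabilizer_def)
      moreover have "g = h \<otimes> (inv h \<otimes> g)"
        using g h by (simp add: m_assoc[symmetric])
      ultimately show "g \<in> (\<lambda>k. h \<otimes> k) ` stabilizer G \<phi> x" by blast
    qed
    then show ?thesis using stab finite_subset by blast
  next
    case False
    then have "{g \<in> S. \<phi> g x = y} = {}" by auto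
    then show ?thesis by (simp only: finite.emptyI)
  qed
  moreover have "S = (\<Union>y\<in>(\<lambda>g. \<phi> g x) ` S. {g \<in> S. \<phi> g x = y})" by auto
  ultimately show ?thesis using img by (metis (no_types, lifting) finite_UN)
qed

text \<open>Induction on the length of a walk joining the two vertices. Elements of the common
  stabiliser that also fix an inner vertex or an edge of a shortest walk are finitely many. Each
  remaining element moves the walk to one that closes up with it to a circuit of length
  \<open>2 * n\<close> through the first edge.\<close>

lemma fine_graph_finite_common_stabilizer:
  assumes graph: "is_graph \<Gamma>" and connected: "connected_graph \<Gamma>"
    and acts: "acts_on_graph G \<Gamma> \<phi> \<psi>" and fine: "fine_graph \<Gamma>"
    and edge_stab: "\<And>e. e \<in> edges \<Gamma> \<Longrightarrow> finite (stabilizer G \<psi> e)"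
    and uv: "u \<in> verts \<Gamma>" "v \<in> verts \<Gamma>" "u \<noteq> v"
  shows "finite (stabilizer G \<phi> u \<inter> stabilizer G \<phi> v)"
proof -
  interpret V: group_action G "verts \<Gamma>" \<phi>
    using acts by (simp add: acts_on_graph_def)
  interpret E: group_action G "edges \<Gamma>" \<psi>
    using acts by (simp add: acts_on_graph_def)
  have ends_act: "ends \<Gamma> (\<psi> g e) = \<phi> g ` ends \<Gamma> e" if "g \<in> carrier G" "e \<in> edges \<Gamma>" for g e
    using acts that by (simp add: acts_on_graph_def)
  have "finite (stabilizer G \<phi> (x 0) \<inter> stabilizer G \<phi> (x n))"
    if "walk \<Gamma> x e n" "x 0 \<noteq> x n" for x e n
    using that
  proof (induction n arbitrary: x e rule: less_induct)
    case (less n)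
    note x = less.prems(1)
    define K where "K = stabilizer G \<phi> (x 0) \<inter> stabilizer G \<phi> (x n)"
    have "n > 0" using less.prems by (cases n) auto
    show ?case
    proof (cases "\<exists>z d m. walk \<Gamma> z d m \<and> z 0 = x 0 \<and> z m = x n \<and> m < n")
      \<comment> \<open>A shorter walk between the same endpoints reduces the claim to the induction
        hypothesis; otherwise the walk is shortest.\<close>
      case True
      then show ?thesis using less.IH less.prems(2) by metis
    next
      case False
      then have minimal: "n \<le> m" if "walk \<Gamma> z d m" "z 0 = x 0" "z m = x n" for z d m
        using that by (meson not_le)
      have xx: "i = j" if "i \<le> n" "j \<le> n" "x i = x j" for i j
        by (rule shortest_walks_levels[OF x x refl refl _ that]) (fact minimal)
      \<comment> \<open>The elements whose translate of the walk fails to form a circuit with it.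
        The first union is finite by induction, as \<open>x i\<close> is reached in
        \<open>i < n\<close> steps, the second by finiteness of edge stabilisers.\<close>
      define bad where
        "bad = (\<Union>i\<in>{0<..<n}. stabilizer G \<phi> (x 0) \<inter> stabilizer G \<phi> (x i)) \<union>
               (\<Union>i\<in>{..<n}. stabilizer G \<psi> (e i))"
      have "finite (stabilizer G \<phi> (x 0) \<inter> stabilizer G \<phi> (x i))" if "0 < i" "i < n" for i
      proof (rule less.IH[of i x e])
        show "walk \<Gamma> x e i" using x that by (simp add: walk_def)
        show "x 0 \<noteq> x i" using xx[of 0 i] that by auto
      qed (use that in simp)
      then have "finite bad"
        unfolding bad_def using edge_stab walk_edge(1)[OF x]
        by (intro finite_UnI finite_UN_I) auto
      \<comment> \<open>The last edge of the circuit is the translate of \<open>e 0\<close>, so the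
        circuit determines where \<open>k\<close> sends \<open>e 0\<close>.\<close>
      have circ: "\<exists>vs es. circuit \<Gamma> vs es \<and> length es = 2 * n \<and> e 0 \<in> set es \<and> last es = \<psi> k (e 0)"
        if k: "k \<in> K - bad" for k
      proof -
        let ?y = "\<lambda>i. \<phi> k (x i)" and ?f = "\<lambda>i. \<psi> k (e i)"
        have kG: "k \<in> carrier G" and k0: "?y 0 = x 0" and kn: "?y n = x n"
          using k by (auto simp: K_def stabilizer_def)
        have y: "walk \<Gamma> ?y ?f n"
          unfolding walk_def
          using walk_edge[OF x] ends_act[OF kG] E.element_image[OF kG _ refl] by auto
        have xy: "i = j" if "i \<le> n" "j \<le> n" "x i = ?y j" for i j
          by (rule shortest_walks_levels[OF x y k0[symmetric] kn[symmetric] _ that]) (fact minimal)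
        \<comment> \<open>The element \<open>k\<close> fixes both endpoints, so
          \<open>minimal\<close> applies to the translated walk as well.\<close>
        have yy: "i = j" if "i \<le> n" "j \<le> n" "?y i = ?y j" for i j
          using shortest_walks_levels[OF y y refl refl _ that] minimal k0 kn by metis
        have "circuit \<Gamma> (map (\<lambda>t. if t \<le> n then x t else ?y (2 * n - t)) [0..<2 * n])
                        (map (\<lambda>t. if t < n then e t else ?f (2 * n - 1 - t)) [0..<2 * n])"
          (is "circuit \<Gamma> ?vs ?es")
        proof (rule walks_circuit[OF graph x y \<open>n > 0\<close> k0[symmetric] kn[symmetric] xx yy xy])
          show "x i \<noteq> ?y i" if "0 < i" "i < n" for i
          proof
            assume "x i = ?y i"
            from this[symmetric] have "k \<in> stabilizer G \<phi> (x 0) \<inter> stabilizer G \<phi> (x i)"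
              using k kG by (simp add: K_def stabilizer_def)
            then have "k \<in> bad" using that by (auto simp: bad_def)
            then show False using k by simp
          qed
          show "e i \<noteq> ?f i" if "i < n" for i
            using k kG that by (force simp: bad_def stabilizer_def)
        qed
        moreover have "e 0 \<in> set ?es"
        proof -
          have "(\<lambda>t. if t < n then e t else ?f (2 * n - 1 - t)) 0 \<in> set ?es"
            unfolding set_map using \<open>n > 0\<close> by (intro imageI) simp
          then show ?thesis using \<open>n > 0\<close> by simp
        qed
        moreover have "last ?es = ?f 0"
          using \<open>n > 0\<close> by (auto simp: last_map)
        ultimately show ?thesis by (intro exI[of _ ?vs] exI[of _ ?es]) simp
      qed
      have e0: "e 0 \<in> edges \<Gamma>" using walk_edge(1)[OF x \<open>n > 0\<close>] .
      \<comment> \<open>Fineness at \<open>e 0\<close> leaves finitely many circuits, hence finitely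
        many translates of \<open>e 0\<close>; its finite stabiliser then bounds the number of
        elements.\<close>
      have "(\<lambda>k. \<psi> k (e 0)) ` (K - bad) \<subseteq>
          (\<lambda>(vs, es). last es) ` {(vs, es). circuit \<Gamma> vs es \<and> length es = 2 * n \<and> e 0 \<in> set es}"
        using circ by (force simp: image_iff)
      moreover have "finite {(vs, es). circuit \<Gamma> vs es \<and> length es = 2 * n \<and> e 0 \<in> set es}"
        using fine e0 by (simp add: fine_graph_def)
      ultimately have "finite ((\<lambda>k. \<psi> k (e 0)) ` (K - bad))"
        by (meson finite_imageI finite_subset)
      moreover have "K - bad \<subseteq> carrier G"
        by (auto simp: K_def stabilizer_def)
      ultimately have "finite (K - bad)"
        using E.finite_of_finite_image e0 edge_stab by blast
      then show ?thesis using \<open>finite bad\<close> K_def by simp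
    qed
  qed
  moreover obtain x e n where "walk \<Gamma> x e n" "x 0 = u" "x n = v"
    using connected uv edge_path_imp_walk unfolding connected_graph_def by metis
  ultimately show ?thesis using uv by metis
qed

text \<open>An edge \<open>\<psi> g d\<close> meets \<open>v\<close> only if \<open>g\<close>
  carries an end \<open>w\<close> of \<open>d\<close> to \<open>v\<close>. Such \<open>g\<close> lie
  in one right coset of the stabiliser of \<open>v\<close>, so a finite stabiliser would leave
  finitely many edges at \<open>v\<close> in each of the finitely many orbits.\<close>

lemma infinite_valence_infinite_stabilizer:
  fixes G (structure)
  assumes graph: "is_graph \<Gamma>" and acts: "acts_on_graph G \<Gamma> \<phi> \<psi>"
    and orbits: "finite (orbits G (edges \<Gamma>) \<psi>)"
    and v: "v \<in> verts \<Gamma>" "infinite_valence \<Gamma> v"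
  shows "infinite (stabilizer G \<phi> v)"
proof
  assume stab: "finite (stabilizer G \<phi> v)"
  interpret V: group_action G "verts \<Gamma>" \<phi>
    using acts by (simp add: acts_on_graph_def)
  interpret E: group_action G "edges \<Gamma>" \<psi>
    using acts by (simp add: acts_on_graph_def)
  interpret group G using V.group_hom group_hom.axioms(1) by blast
  have ends_act: "ends \<Gamma> (\<psi> g e) = \<phi> g ` ends \<Gamma> e" if "g \<in> carrier G" "e \<in> edges \<Gamma>" for g e
    using acts that by (simp add: acts_on_graph_def)
  have "finite {e \<in> Q. v \<in> ends \<Gamma> e}" if Q: "Q \<in> orbits G (edges \<Gamma>) \<psi>" for Q
  proof -
    obtain d where d: "d \<in> edges \<Gamma>" and Q_eq: "Q = orbit G \<psi> d"
      using Q unfolding orbits_def by blast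
    \<comment> \<open>Positive cardinality entails finiteness, since \<open>card\<close> is 0 on
      infinite sets.\<close>
    have "card (ends \<Gamma> d) > 0" and d_verts: "ends \<Gamma> d \<subseteq> verts \<Gamma>"
      using graph d by (auto simp: is_graph_def)
    then have d_ends: "finite (ends \<Gamma> d)"
      using card_ge_0_finite by blast
    have "finite {\<psi> g d | g. g \<in> carrier G \<and> \<phi> g w = v}" if "w \<in> ends \<Gamma> d" for w
    proof (cases "\<exists>h\<in>carrier G. \<phi> h w = v")
      case True
      then obtain h where h: "h \<in> carrier G" "\<phi> h w = v" by auto
      have w: "w \<in> verts \<Gamma>" using that d_verts by auto
      have "{\<psi> g d | g. g \<in> carrier G \<and> \<phi> g w = v} \<subseteq> (\<lambda>k. \<psi> (k \<otimes> h) d) ` stabilizer G \<phi> v"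
      proof
        fix y assume "y \<in> {\<psi> g d | g. g \<in> carrier G \<and> \<phi> g w = v}"
        then obtain g where y: "y = \<psi> g d" and g: "g \<in> carrier G" "\<phi> g w = v" by blast
        have "\<phi> (g \<otimes> inv h) v = v"
          using V.composition_rule[OF v(1), of g "inv h"] V.orbit_sym_aux[OF h(1) w h(2)] g h
          by simp
        then have "g \<otimes> inv h \<in> stabilizer G \<phi> v"
          using g h by (simp add: stabilizer_def)
        moreover have "y = \<psi> ((g \<otimes> inv h) \<otimes> h) d"
          using g h by (simp add: m_assoc y)
        ultimately show "y \<in> (\<lambda>k. \<psi> (k \<otimes> h) d) ` stabilizer G \<phi> v"
          by (rule rev_image_eqI)
      qed
      then show ?thesis using stab finite_subset by blast
    next
      case False
      then have "{\<psi> g d | g. g \<in> carrier G \<and> \<phi> g w = v} = {}" by auto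
      then show ?thesis by (metis finite.emptyI)
    qed
    moreover have "{e \<in> Q. v \<in> ends \<Gamma> e} \<subseteq>
        (\<Union>w\<in>ends \<Gamma> d. {\<psi> g d | g. g \<in> carrier G \<and> \<phi> g w = v})"
    proof
      fix e assume "e \<in> {e \<in> Q. v \<in> ends \<Gamma> e}"
      then obtain g where g: "g \<in> carrier G" "e = \<psi> g d" and "v \<in> ends \<Gamma> e"
        by (auto simp: Q_eq orbit_def)
      then obtain w where "w \<in> ends \<Gamma> d" "\<phi> g w = v" using ends_act d by auto
      then show "e \<in> (\<Union>w\<in>ends \<Gamma> d. {\<psi> g d | g. g \<in> carrier G \<and> \<phi> g w = v})"
        using g by blast
    qed
    ultimately show ?thesis
      using d_ends by (meson finite_UN finite_subset)
  qed
  moreover have "{e \<in> edges \<Gamma>. v \<in> ends \<Gamma> e} \<subseteq>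
      (\<Union>Q\<in>orbits G (edges \<Gamma>) \<psi>. {e \<in> Q. v \<in> ends \<Gamma> e})"
    using E.orbit_refl by (auto simp: orbits_def)
  ultimately have "finite {e \<in> edges \<Gamma>. v \<in> ends \<Gamma> e}"
    using orbits by (meson finite_UN finite_subset)
  then show False using v by (simp add: infinite_valence_def)
qed

text \<open>The obstruction in general form: one proper subgroup in the family already gives a
  contradiction.\<close>

lemma infinite_center_not_strongly_hyperbolic_relative:
  fixes G (structure)
  assumes "group G"
    and center: "infinite {z \<in> carrier G. \<forall>g\<in>carrier G. z \<otimes> g = g \<otimes> z}" (is "infinite ?Z")
    and L: "L \<in> \<L>" "subgroup L G" "L \<noteq> carrier G"
  shows "\<not> strongly_hyperbolic_relative_to TYPE('v) TYPE('e) G \<L>"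
proof
  interpret group G by fact
  assume "strongly_hyperbolic_relative_to TYPE('v) TYPE('e) G \<L>"
  then obtain \<Gamma> :: "('v, 'e) ugraph" and \<phi> \<psi> where
    graph: "is_graph \<Gamma>" and connected: "connected_graph \<Gamma>"
    and acts: "acts_on_graph G \<Gamma> \<phi> \<psi>" and fine: "fine_graph \<Gamma>"
    and orbits: "finite (orbits G (edges \<Gamma>) \<psi>)"
    and "\<forall>e\<in>edges \<Gamma>. finite (stabilizer G \<psi> e)"
    and peripheral: "{stabilizer G \<phi> v | v. v \<in> verts \<Gamma> \<and> infinite_valence \<Gamma> v} =
          {g <# L #> inv g | g L. g \<in> carrier G \<and> L \<in> \<L>}"
    unfolding strongly_hyperbolic_relative_to_def by (elim exE conjE) (rule that)
  then have edge_stab: "\<And>e. e \<in> edges \<Gamma> \<Longrightarrow> finite (stabilizer G \<psi> e)" by blast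
  interpret V: group_action G "verts \<Gamma>" \<phi>
    using acts by (simp add: acts_on_graph_def)
  have L_sub: "L \<subseteq> carrier G" using L by (simp add: subgroup.subset)
  \<comment> \<open>Conjugation by the identity shows that \<open>L\<close> itself, not just a
    conjugate, is a vertex stabiliser.\<close>
  then have "L = \<one> <# L #> inv \<one>"
    by (simp add: lcos_mult_one coset_mult_one)
  then have "L \<in> {g <# L #> inv g | g L. g \<in> carrier G \<and> L \<in> \<L>}"
    using L(1) one_closed by (intro CollectI exI conjI)
  then obtain v where v: "v \<in> verts \<Gamma>" "infinite_valence \<Gamma> v" and L_eq: "L = stabilizer G \<phi> v"
    unfolding peripheral[symmetric] by blast
  have "infinite L"
    using infinite_valence_infinite_stabilizer[OF graph acts orbits v] L_eq by simp
  note finite_inter = fine_graph_finite_common_stabilizer[OF graph connected acts fine edge_stab]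
  have Z_sub: "?Z \<subseteq> stabilizer G \<phi> v"
  proof
    fix z assume z: "z \<in> ?Z"
    then have zG: "z \<in> carrier G" by simp
    \<comment> \<open>For \<open>p\<close> in \<open>L\<close>, centrality of \<open>z\<close> gives
      \<open>p z v = z p v = z v\<close>.\<close>
    have "L \<subseteq> stabilizer G \<phi> v \<inter> stabilizer G \<phi> (\<phi> z v)"
    proof
      fix p assume p: "p \<in> L"
      then have pG: "p \<in> carrier G" and "\<phi> p v = v" by (auto simp: L_eq stabilizer_def)
      then have "\<phi> p (\<phi> z v) = \<phi> z v"
        using V.composition_rule[OF v(1) pG zG] V.composition_rule[OF v(1) zG pG] z by auto
      then show "p \<in> stabilizer G \<phi> v \<inter> stabilizer G \<phi> (\<phi> z v)"
        using p pG by (simp add: L_eq stabilizer_def)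
    qed
    then have "infinite (stabilizer G \<phi> v \<inter> stabilizer G \<phi> (\<phi> z v))"
      using \<open>infinite L\<close> finite_subset by blast
    then have "\<phi> z v = v"
      using finite_inter[OF _ v(1) V.element_image[OF zG v(1) refl]] by metis
    then show "z \<in> stabilizer G \<phi> v"
      using zG by (simp add: stabilizer_def)
  qed
  have "g \<in> L" if g: "g \<in> carrier G" for g
  proof -
    \<comment> \<open>The same computation with the roles exchanged: the centre fixes
      \<open>v\<close>, hence every translate of \<open>v\<close>.\<close>
    have "?Z \<subseteq> stabilizer G \<phi> v \<inter> stabilizer G \<phi> (\<phi> g v)"
    proof
      fix z assume z: "z \<in> ?Z"
      then have zG: "z \<in> carrier G" and zv: "z \<in> stabilizer G \<phi> v" using Z_sub by auto
      then have "\<phi> z (\<phi> g v) = \<phi> g v"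
        using V.composition_rule[OF v(1) g zG] V.composition_rule[OF v(1) zG g] z g
        by (auto simp: stabilizer_def)
      then show "z \<in> stabilizer G \<phi> v \<inter> stabilizer G \<phi> (\<phi> g v)"
        using zv zG by (simp add: stabilizer_def)
    qed
    then have "infinite (stabilizer G \<phi> v \<inter> stabilizer G \<phi> (\<phi> g v))"
      using center finite_subset by blast
    then have "\<phi> g v = v"
      using finite_inter[OF _ v(1) V.element_image[OF g v(1) refl]] by metis
    then show ?thesis using g by (simp add: L_eq stabilizer_def)
  qed
  then show False using L_sub L(3) by auto
qed

section \<open>Words modulo relations as a group with the expected generators\<close>

section \<open>Presented groups\<close>

lemma equiv_word_rel: "equiv UNIV (word_rel R)"
proof (rule equivI)
  show "refl (word_rel R)" by (simp add: refl_on_def word_rel_def)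
  show "sym (word_rel R)" by (auto simp: sym_def word_rel_def intro: equivclp_sym)
  show "trans (word_rel R)" by (auto simp: trans_def word_rel_def intro: equivclp_trans)
qed auto

lemma word_step_append:
  assumes "word_step R u v"
  shows "word_step R (p @ u @ q) (p @ v @ q)"
  using assms
proof cases
  case (cancel u' x s v')
  then show ?thesis using word_step.cancel[of R "p @ u'" x s "v' @ q"] by simp
next
  case (relation r r' u' v')
  then show ?thesis using word_step.relation[of r r' R "p @ u'" "v' @ q"] by simp
qed

lemma word_rel_append_context:
  assumes "(u, v) \<in> word_rel R"
  shows "(p @ u @ q, p @ v @ q) \<in> word_rel R"
proof -
  have "equivclp (word_step R) u v" using assms by (simp add: word_rel_def)
  then have "equivclp (word_step R) (p @ u @ q) (p @ v @ q)"
  proof (induction rule: equivclp_induct)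
    case (step y z)
    then have "word_step R (p @ y @ q) (p @ z @ q) \<or> word_step R (p @ z @ q) (p @ y @ q)"
      using word_step_append by blast
    with step.IH show ?case by (rule equivclp_into_equivclp)
  qed simp
  then show ?thesis by (simp add: word_rel_def)
qed

lemma word_rel_append:
  assumes "(u, u') \<in> word_rel R" "(v, v') \<in> word_rel R"
  shows "(u @ v, u' @ v') \<in> word_rel R"
  using word_rel_append_context[OF assms(1), of "[]" v]
    word_rel_append_context[OF assms(2), of u' "[]"] equiv_word_rel[of R]
  by (auto elim!: equivE dest: transD)

abbreviation word_class :: "('g word \<times> 'g word) set \<Rightarrow> 'g word \<Rightarrow> 'g word set" where
  "word_class R w \<equiv> word_rel R `` {w}"

lemma word_class_eq_iff: "word_class R u = word_class R v \<longleftrightarrow> (u, v) \<in> word_rel R"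
  using eq_equiv_class_iff[OF equiv_word_rel] by blast

lemma carrier_presented_group: "carrier (presented_group R) = range (word_class R)"
  by (auto simp: presented_group_def quotient_def)

lemma one_presented_group: "\<one>\<^bsub>presented_group R\<^esub> = word_class R []"
  by (simp add: presented_group_def)

lemma mult_presented_group:
  "word_class R u \<otimes>\<^bsub>presented_group R\<^esub> word_class R v = word_class R (u @ v)"
proof -
  have "congruent2 (word_rel R) (word_rel R) (\<lambda>u v. word_class R (u @ v))"
    unfolding congruent2_def word_class_eq_iff by (auto intro: word_rel_append)
  then show ?thesis
    using UN_equiv_class2[OF equiv_word_rel equiv_word_rel, of R R _ u v]
    by (simp add: presented_group_def)
qed

lemma word_rel_relation: "(r, r') \<in> R \<Longrightarrow> (r, r') \<in> word_rel R"
  using word_step.relation[of r r' R "[]" "[]"] by (auto simp: word_rel_def intro: r_into_equivclp)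

lemma word_rel_cancel: "([(x, s), (x, \<not> s)], []) \<in> word_rel R"
  using word_step.cancel[of R "[]" x s "[]"] by (auto simp: word_rel_def intro: r_into_equivclp)

text \<open>The first letter of the word meets its inverse in the middle; cancelling this pair
  leaves the claim for the tail.\<close>

lemma word_rel_inv_word: "(inv_word w @ w, []) \<in> word_rel R"
proof (induction w)
  case Nil
  then show ?case by (simp add: inv_word_def word_rel_def)
next
  case (Cons l w)
  obtain x s where l: "l = (x, s)" by (cases l)
  have "(inv_word (l # w) @ l # w, inv_word w @ w) \<in> word_rel R"
    using word_rel_append_context[OF word_rel_cancel[of x "\<not> s"], of "inv_word w" w]
    by (simp add: l inv_word_def)
  then show ?case using Cons equiv_word_rel[of R] by (auto elim!: equivE dest: transD)
qed

lemma group_presented_group: "group (presented_group R)"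
proof (rule groupI)
  fix x assume "x \<in> carrier (presented_group R)"
  then obtain w where "x = word_class R w" by (auto simp: carrier_presented_group)
  then have "word_class R (inv_word w) \<otimes>\<^bsub>presented_group R\<^esub> x = \<one>\<^bsub>presented_group R\<^esub>"
    by (simp add: mult_presented_group one_presented_group word_class_eq_iff word_rel_inv_word)
  then show "\<exists>y\<in>carrier (presented_group R). y \<otimes>\<^bsub>presented_group R\<^esub> x = \<one>\<^bsub>presented_group R\<^esub>"
    by (auto simp: carrier_presented_group)
qed (auto simp: carrier_presented_group mult_presented_group one_presented_group)

lemma inv_word_class_generator:
  "inv\<^bsub>presented_group R\<^esub> (word_class R [(x, True)]) = word_class R [(x, False)]"
proof (rule group.inv_equality[OF group_presented_group])
  show "word_class R [(x, False)] \<otimes>\<^bsub>presented_group R\<^esub> word_class R [(x, True)]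
      = \<one>\<^bsub>presented_group R\<^esub>"
    using word_rel_cancel[of x False R]
    by (simp add: mult_presented_group one_presented_group word_class_eq_iff)
qed (auto simp: carrier_presented_group)

text \<open>Serves twice: for finite generation, and for reducing centrality to commuting with
  generators.\<close>

lemma generate_presented_group:
  "generate (presented_group R) (range (\<lambda>x. word_class R [(x, True)])) = carrier (presented_group R)"
    (is "generate ?G ?S = _")
proof
  show "generate ?G ?S \<subseteq> carrier ?G"
    by (rule group.generate_incl[OF group_presented_group]) (auto simp: carrier_presented_group)
  have letter: "word_class R [(x, s)] \<in> generate ?G ?S" for x s
    using generate.incl[of "word_class R [(x, True)]" ?S ?G]
      generate.inv[of "word_class R [(x, True)]" ?S ?G]
    by (cases s) (auto simp: inv_word_class_generator)
  have "word_class R w \<in> generate ?G ?S" for w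
  proof (induction w)
    case Nil
    show ?case using generate.one[of ?G ?S] by (simp add: one_presented_group)
  next
    case (Cons l w)
    obtain x s where l: "l = (x, s)" by (cases l)
    show ?case
      using generate.eng[OF letter[of x s] Cons] by (simp add: mult_presented_group l)
  qed
  then show "carrier ?G \<subseteq> generate ?G ?S"
    by (auto simp: carrier_presented_group)
qed

section \<open>Integer matrices as a test for the order of the central generator\<close>

section \<open>The Heisenberg group\<close>

instance heisenberg_gen :: finite
proof
  have "(UNIV :: heisenberg_gen set) = {heisenberg_gen.a, heisenberg_gen.b, heisenberg_gen.c}"
    using heisenberg_gen.exhaust by auto
  then show "finite (UNIV :: heisenberg_gen set)" by (metis finite.simps)
qed

definition heisenberg_relations :: "(heisenberg_gen word \<times> heisenberg_gen word) set" where
  "heisenberg_relations =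
     { (comm_word [(heisenberg_gen.a, True)] [(heisenberg_gen.b, True)], [(heisenberg_gen.c, True)]),
       (comm_word [(heisenberg_gen.a, True)] [(heisenberg_gen.c, True)], []),
       (comm_word [(heisenberg_gen.b, True)] [(heisenberg_gen.c, True)], []) }"

lemma heisenberg_group_eq: "heisenberg_group = presented_group heisenberg_relations"
  by (simp add: heisenberg_group_def heisenberg_relations_def)

text \<open>
  The triple \<open>(p, q, r)\<close> stands for the upper unitriangular matrix
  \<open>[[1, p, r], [0, 1, q], [0, 0, 1]]\<close>.
\<close>

fun heis_mult :: "int \<times> int \<times> int \<Rightarrow> int \<times> int \<times> int \<Rightarrow> int \<times> int \<times> int" where
  "heis_mult (p, q, r) (p', q', r') = (p + p', q + q', r + r' + p * q')"

fun heis_letter :: "heisenberg_gen \<times> bool \<Rightarrow> int \<times> int \<times> int" where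
  "heis_letter (x, s) =
     (let k = if s then 1 else -1 in
      case x of
        heisenberg_gen.a \<Rightarrow> (k, 0, 0)
      | heisenberg_gen.b \<Rightarrow> (0, k, 0)
      | heisenberg_gen.c \<Rightarrow> (0, 0, k))"

definition heis_eval :: "heisenberg_gen word \<Rightarrow> int \<times> int \<times> int" where
  "heis_eval w = foldr (\<lambda>l. heis_mult (heis_letter l)) w (0, 0, 0)"

lemma heis_mult_assoc: "heis_mult (heis_mult x y) z = heis_mult x (heis_mult y z)"
  by (cases x; cases y; cases z) (simp add: algebra_simps)

lemma heis_mult_zero: "heis_mult (0, 0, 0) x = x"
  by (cases x) simp

lemma heis_eval_append: "heis_eval (u @ v) = heis_mult (heis_eval u) (heis_eval v)"
  by (induction u) (simp_all add: heis_eval_def heis_mult_assoc heis_mult_zero)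

text \<open>The matrices satisfy the defining relations, so evaluation is constant on classes and
  can separate elements of the presented group.\<close>

lemma heis_eval_word_step:
  assumes "word_step heisenberg_relations u v"
  shows "heis_eval u = heis_eval v"
  using assms
proof cases
  case (cancel u' x s v')
  have "heis_eval [(x, s), (x, \<not> s)] = heis_eval []"
    by (simp add: heis_eval_def split: heisenberg_gen.split)
  then show ?thesis unfolding cancel by (metis append_Nil heis_eval_append)
next
  case (relation r r' u' v')
  have "heis_eval r = heis_eval r'"
    using relation(3) by (auto simp: heisenberg_relations_def comm_word_def inv_word_def heis_eval_def)
  then show ?thesis unfolding relation by (simp add: heis_eval_append)
qed

lemma heis_eval_word_rel:
  assumes "(u, v) \<in> word_rel heisenberg_relations"
  shows "heis_eval u = heis_eval v"
proof -
  have "equivclp (word_step heisenberg_relations) u v" using assms by (simp add: word_rel_def)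
  then show ?thesis
    by (induction rule: equivclp_induct) (auto dest: heis_eval_word_step)
qed

lemma heis_eval_c_power: "heis_eval (replicate n (heisenberg_gen.c, True)) = (0, 0, int n)"
  by (induction n) (simp_all add: heis_eval_def)

lemma heisenberg_center_infinite:
  "infinite {z \<in> carrier heisenberg_group.
      \<forall>g\<in>carrier heisenberg_group. z \<otimes>\<^bsub>heisenberg_group\<^esub> g = g \<otimes>\<^bsub>heisenberg_group\<^esub> z}"
    (is "infinite ?Z")
proof -
  let ?G = "presented_group heisenberg_relations"
  let ?cl = "word_class heisenberg_relations"
  interpret group ?G by (rule group_presented_group)
  have cl[simp]: "?cl w \<in> carrier ?G" for w by (auto simp: carrier_presented_group)
  define z where "z = ?cl [(heisenberg_gen.c, True)]"
  have zG[simp]: "z \<in> carrier ?G" by (simp add: z_def)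
  have comm_imp: "?cl [(x, True)] \<otimes>\<^bsub>?G\<^esub> z = z \<otimes>\<^bsub>?G\<^esub> ?cl [(x, True)]"
    if "(comm_word [(x, True)] [(heisenberg_gen.c, True)], []) \<in> heisenberg_relations" for x
  proof -
    have "?cl (comm_word [(x, True)] [(heisenberg_gen.c, True)]) = \<one>\<^bsub>?G\<^esub>"
      using word_rel_relation[OF that] by (simp add: word_class_eq_iff one_presented_group)
    \<comment> \<open>The commutator is regrouped as \<open>(x z) (z x)\<inverse>\<close>; its
      triviality then says that \<open>x\<close> and \<open>z\<close> commute.\<close>
    moreover have "?cl (comm_word [(x, True)] [(heisenberg_gen.c, True)]) =
        (?cl [(x, True)] \<otimes>\<^bsub>?G\<^esub> z) \<otimes>\<^bsub>?G\<^esub> inv\<^bsub>?G\<^esub> (z \<otimes>\<^bsub>?G\<^esub> ?cl [(x, True)])"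
      unfolding inv_mult_group[OF zG cl]
      unfolding z_def inv_word_class_generator mult_presented_group
      by (simp add: comm_word_def inv_word_def)
    ultimately show ?thesis
      by (metis (no_types, lifting) cl zG inv_closed inv_equality inv_inv m_closed)
  qed
  have gen: "?cl [(x, True)] \<otimes>\<^bsub>?G\<^esub> z = z \<otimes>\<^bsub>?G\<^esub> ?cl [(x, True)]" for x
  proof (cases "x = heisenberg_gen.c")
    case True
    then show ?thesis by (simp only: z_def)
  next
    case False
    then show ?thesis
      by (intro comm_imp, cases x) (simp_all add: heisenberg_relations_def)
  qed
  have central: "g \<otimes>\<^bsub>?G\<^esub> z = z \<otimes>\<^bsub>?G\<^esub> g" if "g \<in> carrier ?G" for g
  proof -
    have "g \<in> generate ?G (range (\<lambda>x. ?cl [(x, True)]))"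
      using that generate_presented_group by metis
    then show ?thesis
    proof induction
      case (inv h)
      then obtain x where h: "h = ?cl [(x, True)]" by auto
      then have "h \<otimes>\<^bsub>?G\<^esub> z = z \<otimes>\<^bsub>?G\<^esub> h" "h \<in> carrier ?G" using gen by auto
      then show ?case
        by (metis inv_closed inv_solve_left inv_solve_right m_assoc m_closed zG)
    next
      case (eng g h)
      then have "g \<in> carrier ?G" "h \<in> carrier ?G"
        using generate_presented_group by metis+
      then show ?case using eng by (metis m_assoc zG)
    qed (auto simp: gen)
  qed
  \<comment> \<open>The powers of the central generator, written as explicit words so that
    \<open>heis_eval\<close> can tell them apart by the corner entry.\<close>
  define p where "p n = ?cl (replicate n (heisenberg_gen.c, True))" for n
  have p_Suc: "p (Suc n) = z \<otimes>\<^bsub>?G\<^esub> p n" for n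
    by (simp add: p_def z_def mult_presented_group)
  have "g \<otimes>\<^bsub>?G\<^esub> p n = p n \<otimes>\<^bsub>?G\<^esub> g" if "g \<in> carrier ?G" for n g
  proof (induction n)
    case 0
    have "p 0 = \<one>\<^bsub>?G\<^esub>" by (simp add: p_def one_presented_group)
    then show ?case using that by simp
  next
    case (Suc n)
    have "p n \<in> carrier ?G" by (simp add: p_def)
    then show ?case using Suc central[OF that] that by (metis m_assoc p_Suc zG)
  qed
  then have "range p \<subseteq> ?Z"
    by (auto simp: heisenberg_group_eq p_def)
  moreover have "inj p"
  proof (rule injI)
    fix m n assume "p m = p n"
    then show "m = n"
      using heis_eval_word_rel by (fastforce simp: p_def word_class_eq_iff heis_eval_c_power)
  qed
  then have "infinite (range p)" using finite_imageD infinite_UNIV_nat by blast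
  ultimately show ?thesis using finite_subset by blast
qed

theorem proposition18:
  shows "not_strongly_relatively_hyperbolic TYPE('v) TYPE('e) heisenberg_group"
proof -
  have group: "group heisenberg_group"
    by (simp add: heisenberg_group_eq group_presented_group)
  moreover have "finitely_generated heisenberg_group (carrier heisenberg_group)"
    unfolding finitely_generated_def heisenberg_group_eq
    using generate_presented_group[of heisenberg_relations]
    by (intro exI[of _ "range (\<lambda>x. word_class heisenberg_relations [(x, True)])"])
      (auto simp: carrier_presented_group)
  ultimately show ?thesis
    unfolding not_strongly_relatively_hyperbolic_def
    \<comment> \<open>The family \<open>\<L>\<close> is nonempty, and any member of it is a proper
      subgroup to which the obstruction applies.\<close>
    using infinite_center_not_strongly_hyperbolic_relative[OF group heisenberg_center_infinite]
    by blast
qed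

end
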